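(* Assume $n$ is even. Let $\phi:H_{\bar0}\to W_{\bar1}$ be a $\mathbb Z$-homogeneous derivation (i.e. $\phi([x,y])=[\phi(x),y]+[x,\phi(y)]$ for $x,y\in H_{\bar0}$) with $\phi((H_{\bar0})_{-1}\oplus(H_{\bar0})_0)=0$. Then $\phi=0$.
   Context: Let $\mathbb F$ be an algebraically closed field of characteristic $p>3$. Fix positive integers $m=2r$ and $n$; write $n=2s$ if $n$ is even and $n=2s+1$ if $n$ is odd. Put $I_0=\{1,\dots,m\}$, $I_1=\{m+1,\dots,m+n\}$, $I=I_0\cup I_1$. Fix positive integers $t_1,\dots,t_m$, put $\pi=(\pi_1,\dots,\pi_m)$ with $\pi_i=p^{t_i}-1$, and $\mathbb A=\{\alpha\in\mathbb N_0^m:\alpha_i\le\pi_i\ \forall i\}$; $\varepsilon_i$ is the $i$-th unit vector and $|\alpha|=\sum\alpha_i$. Let $\mathbb B$ be the set of strictly increasing sequences $u=\langle i_1<\dots<i_k\rangle$ of elements of $I_1$ (including $\emptyset$), $|u|=k$, $\mathbb B^0=\{u\in\mathbb B:|u|\text{ even}\}$, $\omega=\langle m+1,\dots,m+n\rangle$. Let $\mathcal O=\mathcal O(m,n;\underline t)$ be the supercommutative associative superalgebra with basis $x^{(\alpha)}x^u$ ($\alpha\in\mathbb A,u\in\mathbb B$), where $x^{(\alpha)}x^{(\beta)}=\binom{\alpha+\beta}{\alpha}x^{(\alpha+\beta)}$, $x^{(\alpha)}$ even, $x_{m+1},\dots,x_{m+n}$ odd and pairwise anticommuting, $x^u=x_{i_1}\cdots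 x_{i_k}$, $x^\emptyset=1$, $x_i:=x^{(\varepsilon_i)}$ for $i\in I_0$, $\mathbb Z$-graded by $\mathrm{zd}(x^{(\alpha)}x^u)=|\alpha|+|u|$. For $i\in I$ let $\partial_i$ be the superderivation of $\mathcal O$ with $\partial_i(x^{(\alpha)})=x^{(\alpha-\varepsilon_i)}$ for $i\in I_0$ and $\partial_i(x_k)=\delta_{ik}$ for $i\in I_1$; parity $\mu(i)=\bar0$ for $i\in I_0$, $\mu(i)=\bar1$ for $i\in I_1$. $W=\{\sum_{i\in I}f_i\partial_i: f_i\in\mathcal O\}$ is the Lie superalgebra with bracket $[f\partial_i,g\partial_j]=f\partial_i(g)\partial_j-(-1)^{p(f\partial_i)p(g\partial_j)}g\partial_j(f)\partial_i$, $\mathbb Z$-graded by $\mathrm{zd}(f\partial_j)=\mathrm{zd}(f)-1$, with even and odd parts $W_{\bar 0},W_{\bar1}$. Define $i'=i+r$ ($1\le i\le r$), $i'=i-r$ ($r<i\le m$), $i'=i+s$ ($m<i\le m+s$), $i'=i-s$ ($m+s<i\le m+2s$), $i'=i$ otherwise; $\tau(i)=1$ for $1\le i\le r$, $\tau(i)=-1$ for $r<i\le m$, $\tau(i)=1$ for $i\in I_1$. For $f\in\mathcal O$ put $D_H(f)=\sum_{i\in I}\tau(i)(-1)^{\mu(i)p(f)}\partial_i(f)\partial_{i'}$. Let $H_{\bar0}=\mathrm{span}_{\mathbb F}\{D_H(x^{(\alpha)}x^u):\alpha\in\mathbb A,u\in\mathbb B^0,(\alpha,u)\ne(\pi,\omega)\}$,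 a $\mathbb Z$-graded subalgebra of $W_{\bar0}$ with $\mathrm{zd}(D_H(f))=\mathrm{zd}(f)-2$ and homogeneous components $(H_{\bar0})_k$. A linear map between $\mathbb Z$-graded spaces is $\mathbb Z$-homogeneous of degree $d$ if it maps degree $k$ into degree $k+d$. *)

theory Defs
  imports "HOL-Computational_Algebra.Polynomial"
begin

(* Monomial index (alpha, u): alpha :: nat => nat (zero outside {1..m}), u a finite subset of I_1
   (identified with the strictly increasing sequence of its elements). *)
type_synonym mon = "(nat \<Rightarrow> nat) \<times> nat set"
(* elements of O: coefficient functions on monomials (supported on the finite basis) *)
type_synonym 'a Oel = "mon \<Rightarrow> 'a"
(* elements of W: sum_i f_i d_i, represented as i |-> f_i *)
type_synonym 'a Wel = "nat \<Rightarrow> mon \<Rightarrow> 'a"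

definition I0 :: "nat \<Rightarrow> nat set" where "I0 m = {1..m}"
definition I1 :: "nat \<Rightarrow> nat \<Rightarrow> nat set" where "I1 m n = {m+1..m+n}"
definition Iset :: "nat \<Rightarrow> nat \<Rightarrow> nat set" where "Iset m n = {1..m+n}"

definition piv :: "nat \<Rightarrow> nat \<Rightarrow> (nat \<Rightarrow> nat) \<Rightarrow> (nat \<Rightarrow> nat)" where
  "piv m p t = (\<lambda>i. if i \<in> I0 m then p ^ t i - 1 else 0)"

definition Aset :: "nat \<Rightarrow> nat \<Rightarrow> (nat \<Rightarrow> nat) \<Rightarrow> (nat \<Rightarrow> nat) set" where
  "Aset m p t = {\<alpha>. \<forall>i. (i \<in> I0 m \<longrightarrow> \<alpha> i \<le> piv m p t i) \<and> (i \<notin> I0 m \<longrightarrow> \<alpha> i = 0)}"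

definition Basis :: "nat \<Rightarrow> nat \<Rightarrow> nat \<Rightarrow> (nat \<Rightarrow> nat) \<Rightarrow> mon set" where
  "Basis m n p t = Aset m p t \<times> Pow (I1 m n)"

definition mono :: "mon \<Rightarrow> 'a::zero_neq_one Oel" where
  "mono b = (\<lambda>c. if c = b then 1 else 0)"

(* number of inversions: x^u x^v = (-1)^invcount u v x^(u \<union> v) for disjoint u, v *)
definition invcount :: "nat set \<Rightarrow> nat set \<Rightarrow> nat" where
  "invcount u v = card {(i,j). i \<in> u \<and> j \<in> v \<and> j < i}"

(* product of basis monomials x^(alpha) x^u * x^(beta) x^v.
   If alpha+beta is not in A, the binomial coefficient vanishes in F, so the product is 0. *)
definition bprod :: "nat \<Rightarrow> nat \<Rightarrow> (nat \<Rightarrow> nat) \<Rightarrow> mon \<Rightarrow> mon \<Rightarrow> 'a::field Oel" where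
  "bprod m p t b1 b2 = (case b1 of (\<alpha>, u) \<Rightarrow> case b2 of (\<beta>, v) \<Rightarrow>
     (if u \<inter> v = {} \<and> (\<lambda>i. \<alpha> i + \<beta> i) \<in> Aset m p t then
        (\<lambda>c. if c = ((\<lambda>i. \<alpha> i + \<beta> i), u \<union> v)
              then of_nat (\<Prod>i\<in>I0 m. (\<alpha> i + \<beta> i) choose \<alpha> i) * (-1) ^ invcount u v
              else 0)
      else (\<lambda>c. 0)))"

definition mulO :: "nat \<Rightarrow> nat \<Rightarrow> nat \<Rightarrow> (nat \<Rightarrow> nat) \<Rightarrow> 'a::field Oel \<Rightarrow> 'a Oel \<Rightarrow> 'a Oel" where
  "mulO m n p t f g = (\<lambda>c. \<Sum>b1\<in>Basis m n p t. \<Sum>b2\<in>Basis m n p t. f b1 * g b2 * bprod m p t b1 b2 c)"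

definition dbasis :: "nat \<Rightarrow> nat \<Rightarrow> nat \<Rightarrow> mon \<Rightarrow> 'a::field Oel" where
  "dbasis m n i b = (case b of (\<alpha>, u) \<Rightarrow>
     if i \<in> I0 m then (if 0 < \<alpha> i then mono (\<alpha>(i := \<alpha> i - 1), u) else (\<lambda>c. 0))
     else if i \<in> I1 m n then
       (if i \<in> u then (\<lambda>c. (-1) ^ card {j \<in> u. j < i} * mono (\<alpha>, u - {i}) c) else (\<lambda>c. 0))
     else (\<lambda>c. 0))"

definition dO :: "nat \<Rightarrow> nat \<Rightarrow> nat \<Rightarrow> (nat \<Rightarrow> nat) \<Rightarrow> nat \<Rightarrow> 'a::field Oel \<Rightarrow> 'a Oel" where
  "dO m n p t i f = (\<lambda>c. \<Sum>b\<in>Basis m n p t. f b * dbasis m n i b c)"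

definition mu :: "nat \<Rightarrow> nat \<Rightarrow> nat \<Rightarrow> nat" where
  "mu m n i = (if i \<in> I1 m n then 1 else 0)"

definition par :: "nat \<Rightarrow> nat \<Rightarrow> mon \<Rightarrow> nat \<Rightarrow> nat" where
  "par m n b i = card (snd b) + mu m n i"

definition singleW :: "nat \<Rightarrow> 'a::zero Oel \<Rightarrow> 'a Wel" where
  "singleW j f = (\<lambda>k. if k = j then f else (\<lambda>c. 0))"

definition brk_basis :: "nat \<Rightarrow> nat \<Rightarrow> nat \<Rightarrow> (nat \<Rightarrow> nat) \<Rightarrow> mon \<Rightarrow> nat \<Rightarrow> mon \<Rightarrow> nat \<Rightarrow> 'a::field Wel" where
  "brk_basis m n p t b1 i b2 j = (\<lambda>k c.
      singleW j (mulO m n p t (mono b1) (dO m n p t i (mono b2))) k c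
    - (-1) ^ (par m n b1 i * par m n b2 j) * singleW i (mulO m n p t (mono b2) (dO m n p t j (mono b1))) k c)"

definition brk :: "nat \<Rightarrow> nat \<Rightarrow> nat \<Rightarrow> (nat \<Rightarrow> nat) \<Rightarrow> 'a::field Wel \<Rightarrow> 'a Wel \<Rightarrow> 'a Wel" where
  "brk m n p t D E = (\<lambda>k c. \<Sum>i\<in>Iset m n. \<Sum>j\<in>Iset m n. \<Sum>b1\<in>Basis m n p t. \<Sum>b2\<in>Basis m n p t.
      D i b1 * E j b2 * brk_basis m n p t b1 i b2 j k c)"

definition Wset :: "nat \<Rightarrow> nat \<Rightarrow> nat \<Rightarrow> (nat \<Rightarrow> nat) \<Rightarrow> 'a::zero Wel set" where
  "Wset m n p t = {D. (\<forall>i b. D i b \<noteq> 0 \<longrightarrow> i \<in> Iset m n \<and> b \<in> Basis m n p t)}"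

definition zdeg :: "nat \<Rightarrow> mon \<Rightarrow> nat" where
  "zdeg m b = (\<Sum>i\<in>I0 m. fst b i) + card (snd b)"

definition Wdeg :: "nat \<Rightarrow> nat \<Rightarrow> nat \<Rightarrow> (nat \<Rightarrow> nat) \<Rightarrow> int \<Rightarrow> 'a::zero Wel set" where
  "Wdeg m n p t k = {D \<in> Wset m n p t. \<forall>i b. D i b \<noteq> 0 \<longrightarrow> int (zdeg m b) - 1 = k}"

definition Wodd :: "nat \<Rightarrow> nat \<Rightarrow> nat \<Rightarrow> (nat \<Rightarrow> nat) \<Rightarrow> 'a::zero Wel set" where
  "Wodd m n p t = {D \<in> Wset m n p t. \<forall>i b. D i b \<noteq> 0 \<longrightarrow> odd (par m n b i)}"

definition primeidx :: "nat \<Rightarrow> nat \<Rightarrow> nat \<Rightarrow> nat" where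
  "primeidx m n i = (let r = m div 2; s = n div 2 in
     if 1 \<le> i \<and> i \<le> r then i + r
     else if r < i \<and> i \<le> m then i - r
     else if m < i \<and> i \<le> m + s then i + s
     else if m + s < i \<and> i \<le> m + 2 * s then i - s
     else i)"

definition tau :: "nat \<Rightarrow> nat \<Rightarrow> 'a::ring_1" where
  "tau m i = (if 1 \<le> i \<and> i \<le> m div 2 then 1 else if m div 2 < i \<and> i \<le> m then -1 else 1)"

definition DH_basis :: "nat \<Rightarrow> nat \<Rightarrow> nat \<Rightarrow> (nat \<Rightarrow> nat) \<Rightarrow> mon \<Rightarrow> 'a::field Wel" where
  "DH_basis m n p t b = (\<lambda>k c. \<Sum>i\<in>Iset m n.
      tau m i * (-1) ^ (mu m n i * card (snd b)) * singleW (primeidx m n i) (dO m n p t i (mono b)) k c)"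

definition H0gens :: "nat \<Rightarrow> nat \<Rightarrow> nat \<Rightarrow> (nat \<Rightarrow> nat) \<Rightarrow> mon set" where
  "H0gens m n p t = {b \<in> Basis m n p t. even (card (snd b)) \<and> b \<noteq> (piv m p t, I1 m n)}"

(* H_0 = span of the D_H(x^(alpha) x^u); the generating set is finite *)
definition H0 :: "nat \<Rightarrow> nat \<Rightarrow> nat \<Rightarrow> (nat \<Rightarrow> nat) \<Rightarrow> 'a::field Wel set" where
  "H0 m n p t = {D. \<exists>a. D = (\<lambda>k c. \<Sum>b\<in>H0gens m n p t. a b * DH_basis m n p t b k c)}"

definition alg_closed :: "'a::field itself \<Rightarrow> bool" where
  "alg_closed _ \<longleftrightarrow> (\<forall>q :: 'a poly. 0 < degree q \<longrightarrow> (\<exists>x. poly q x = 0))"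

end

theory Submission
  imports Defs
begin

text \<open>
  Since \<open>n = 2s\<close> is even, each element \<open>D_H(x_a x_a')\<close> with \<open>a = m + q\<close>, \<open>1 \<le> q \<le> s\<close>, equals
  \<open>x_a' \<partial>_a' - x_a \<partial>_a\<close>; it acts diagonally on the monomials of \<open>W\<close> and, being of degree zero,
  it is killed by \<open>\<phi>\<close>. So \<open>\<phi>\<close> preserves weights. On the generators of \<open>H_0\<close> the weights are
  integers in \<open>[-1, 1]\<close>, on the monomials of \<open>W\<close> they lie in \<open>[-2, 2]\<close>, so for \<open>p > 3\<close> weights
  that agree in the field agree as integers. The sum of the \<open>s\<close> weights is congruent modulo 2
  to the parity, which is even on \<open>H_0\<close> and odd on the odd part of \<open>W\<close>; hence \<open>\<phi>\<close> has nowhere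
  to map a generator but to zero.
\<close>

section \<open>Finiteness of the monomial basis and products of monomials\<close>

lemma finite_Basis: "finite (Basis m n p t)"
proof -
  \<comment> \<open>One common bound for all entries: \<open>finite_set_of_finite_funs\<close> wants
    a single finite set of values.\<close>
  define N where "N = (\<Sum>i\<in>I0 m. piv m p t i)"
  have "piv m p t i \<le> N" if "i \<in> I0 m" for i
    unfolding N_def using that by (intro member_le_sum) (auto simp: I0_def)
  then have "Aset m p t \<subseteq> {\<alpha>. \<forall>i. (i \<in> I0 m \<longrightarrow> \<alpha> i \<in> {..N}) \<and> (i \<notin> I0 m \<longrightarrow> \<alpha> i = 0)}"
    by (auto simp: Aset_def intro: order_trans)
  moreover have "finite \<dots>"
    by (rule finite_set_of_finite_funs) (auto simp: I0_def)
  ultimately have "finite (Aset m p t)" by (rule finite_subset)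
  then show ?thesis by (auto simp: Basis_def I1_def)
qed

lemma sum_scaled_mono:
  assumes "finite B" "b \<in> B"
  shows "(\<Sum>c\<in>B. z * mono b c * (f c :: 'a::field)) = z * f b"
proof -
  have "(\<Sum>c\<in>B. z * mono b c * f c) = (\<Sum>c\<in>B. if c = b then z * f b else 0)"
    by (rule sum.cong) (auto simp: mono_def)
  also have "\<dots> = z * f b" using assms by simp
  finally show ?thesis .
qed

lemma sum_mono_mult:
  assumes "finite B" "b \<in> B"
  shows "(\<Sum>c\<in>B. mono b c * (f c :: 'a::field)) = f b"
  using sum_scaled_mono[OF assms, of 1 f] by (simp only: mult_1_left)

lemma dO_mono:
  assumes "b \<in> Basis m n p t"
  shows "dO m n p t i (mono b :: 'a::field Oel) = dbasis m n i b"
  unfolding dO_def by (simp only: sum_mono_mult[OF finite_Basis assms])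

text \<open>The scalar \<open>z\<close> takes up the sign that \<open>dbasis\<close> puts in front
  of a monomial.\<close>

lemma mulO_mono:
  assumes "b1 \<in> Basis m n p t" "b2 \<in> Basis m n p t"
  shows "mulO m n p t (mono b1) (\<lambda>c. z * mono b2 c)
    = (\<lambda>c. z * bprod m p t b1 b2 c :: 'a::field)"
proof
  fix c
  let ?B = "Basis m n p t"
  have "mulO m n p t (mono b1) (\<lambda>c. z * mono b2 c) c
      = (\<Sum>a1\<in>?B. mono b1 a1 * (\<Sum>a2\<in>?B. z * mono b2 a2 * bprod m p t a1 a2 c))"
    by (simp add: mulO_def sum_distrib_left mult.assoc)
  also have "\<dots> = z * bprod m p t b1 b2 c"
    by (simp add: sum_mono_mult[OF finite_Basis assms(1)] sum_scaled_mono[OF finite_Basis assms(2)])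
  finally show "mulO m n p t (mono b1) (\<lambda>c. z * mono b2 c) c = z * bprod m p t b1 b2 c" .
qed

lemma mulO_zero_right [simp]: "mulO m n p t f (\<lambda>c. 0) = (\<lambda>c. 0 :: 'a::field)"
  by (simp add: mulO_def)

section \<open>Odd variables and the odd Euler operators\<close>

lemma Basis_odd_var: "b \<in> I1 m n \<Longrightarrow> ((\<lambda>_. 0), {b}) \<in> Basis m n p t"
  by (auto simp: Basis_def Aset_def)

lemma Basis_remove_odd: "(\<beta>, v) \<in> Basis m n p t \<Longrightarrow> (\<beta>, v - {b}) \<in> Basis m n p t"
  by (auto simp: Basis_def)

lemma Basis_lower_even: "(\<beta>, v) \<in> Basis m n p t \<Longrightarrow> (\<beta>(i := \<beta> i - 1), v) \<in> Basis m n p t"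
  by (fastforce simp: Basis_def Aset_def)

lemma not_I0_if_I1: "b \<in> I1 m n \<Longrightarrow> b \<notin> I0 m"
  by (auto simp: I0_def I1_def)

lemma bprod_odd_var_left:
  assumes "(\<beta>, v) \<in> Basis m n p t" "b \<notin> v"
  shows "bprod m p t ((\<lambda>_. 0), {b}) (\<beta>, v)
    = (\<lambda>c. (-1) ^ card {j \<in> v. j < b} * mono (\<beta>, insert b v) c :: 'a::field)"
proof -
  have "{(i, j). i \<in> {b} \<and> j \<in> v \<and> j < i} = Pair b ` {j \<in> v. j < b}" by auto
  then have "invcount {b} v = card {j \<in> v. j < b}"
    by (simp add: invcount_def card_image inj_on_def)
  then show ?thesis
    using assms by (auto simp: bprod_def mono_def Basis_def fun_eq_iff)
qed

lemma bprod_one_right: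
  assumes "(\<beta>, v) \<in> Basis m n p t"
  shows "bprod m p t (\<beta>, v) ((\<lambda>_. 0), {}) = (mono (\<beta>, v) :: 'a::field Oel)"
  using assms by (auto simp: bprod_def mono_def Basis_def invcount_def fun_eq_iff)

text \<open>The eigenvalue of the Euler operator x_b d_b on x^(alpha) x^v d_j. It is kept as an
  integer because its size and parity are needed later, and both are lost in the field.\<close>

definition odd_weight :: "nat \<Rightarrow> nat \<Rightarrow> nat set \<Rightarrow> int" where
  "odd_weight b j v = of_bool (b \<in> v) - of_bool (j = b)"

text \<open>The operator x_b d_b has even parity 1 + 1, so the second term of the bracket enters
  with a plain minus sign. The first term restores the monomial if x_b occurs in it, the second if
  the derivation is d_b.\<close>

lemma brk_basis_euler:
  assumes b: "b \<in> I1 m n" and v: "(\<beta>, v) \<in> Basis m n p t" and j: "j \<in> Iset m n"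
  shows "brk_basis m n p t ((\<lambda>_. 0), {b}) b (\<beta>, v) j k c
    = (of_int (odd_weight b j v) * singleW j (mono (\<beta>, v)) k c :: 'a::field)"
proof -
  have nI0: "b \<notin> I0 m" by (rule not_I0_if_I1[OF b])
  have zero: "((\<lambda>_. 0), {b}) \<in> Basis m n p t" "((\<lambda>_. 0), {}) \<in> Basis m n p t"
    using Basis_odd_var[OF b] by (auto simp: Basis_def)
  have first: "mulO m n p t (mono ((\<lambda>_. 0), {b})) (dO m n p t b (mono (\<beta>, v)))
      = (\<lambda>c. of_bool (b \<in> v) * mono (\<beta>, v) c :: 'a)"
  proof (cases "b \<in> v")
    case True
    \<comment> \<open>Taking x_b out and putting it back on the left passes the same odd variables,
      so the two signs cancel.\<close>
    have "{j \<in> v - {b}. j < b} = {j \<in> v. j < b}" by auto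
    moreover have "(-1) ^ l * ((-1) ^ l * x) = x" for l and x :: 'a
      by (simp add: mult.assoc [symmetric] power_mult_distrib [symmetric])
    ultimately show ?thesis
      using True b nI0
      by (simp add: dO_mono[OF v] dbasis_def mulO_mono[OF zero(1) Basis_remove_odd[OF v]]
          bprod_odd_var_left[OF Basis_remove_odd[OF v]] insert_absorb)
  next
    case False
    then show ?thesis
      using b nI0 by (simp add: dO_mono[OF v] dbasis_def)
  qed
  have second: "mulO m n p t (mono (\<beta>, v)) (dO m n p t j (mono ((\<lambda>_. 0), {b})))
      = (\<lambda>c. of_bool (j = b) * mono (\<beta>, v) c :: 'a)"
  proof (cases "j = b")
    case True
    have "dbasis m n b ((\<lambda>_. 0), {b}) = (\<lambda>c. 1 * mono ((\<lambda>_. 0), {}) c :: 'a)"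
    proof -
      have "{j. j = b \<and> j < b} = {}" by auto
      then show ?thesis using b nI0 by (simp add: dbasis_def del: Collect_empty_eq)
    qed
    then show ?thesis
      using True mulO_mono[OF v zero(2), of "1::'a"] bprod_one_right[OF v]
      by (simp add: dO_mono[OF zero(1)])
  next
    case False
    then show ?thesis by (auto simp: dO_mono[OF zero(1)] dbasis_def)
  qed
  show ?thesis
    using b by (auto simp: brk_basis_def first second par_def mu_def singleW_def odd_weight_def)
qed

definition euler_diff :: "nat \<Rightarrow> nat \<Rightarrow> 'a::field Wel" where
  "euler_diff a b = (\<lambda>k c. singleW b (mono ((\<lambda>_. 0), {b})) k c - singleW a (mono ((\<lambda>_. 0), {a})) k c)"

text \<open>Every monomial of \<open>W\<close> is an eigenvector of both Euler operators, so the
  bracket can be read off one coefficient at a time.\<close>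

lemma brk_euler_diff:
  fixes E :: "'a::field Wel"
  assumes a: "a \<in> I1 m n" and b: "b \<in> I1 m n" and E: "E \<in> Wset m n p t"
  shows "brk m n p t (euler_diff a b) E k c
    = of_int (odd_weight b k (snd c) - odd_weight a k (snd c)) * E k c"
proof -
  let ?B = "Basis m n p t" and ?I = "Iset m n"
  have fI: "finite ?I" by (simp add: Iset_def)
  have euler: "(\<Sum>i\<in>?I. \<Sum>b1\<in>?B. singleW d (mono ((\<lambda>_. 0), {d})) i b1 * F i b1)
      = F d ((\<lambda>_. 0), {d})" if d: "d \<in> I1 m n" for d and F :: "nat \<Rightarrow> mon \<Rightarrow> 'a"
  proof -
    have "(\<Sum>i\<in>?I. \<Sum>b1\<in>?B. singleW d (mono ((\<lambda>_. 0), {d})) i b1 * F i b1)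
        = (\<Sum>i\<in>?I. if i = d then F d ((\<lambda>_. 0), {d}) else 0)"
      by (rule sum.cong)
        (auto simp: singleW_def sum_mono_mult[OF finite_Basis Basis_odd_var[OF d]])
    also have "\<dots> = F d ((\<lambda>_. 0), {d})"
      using d by (simp add: Iset_def I1_def)
    finally show ?thesis .
  qed
  \<comment> \<open>The coefficient at \<open>(k, c)\<close> of the bracket of a single term
    \<open>b1\<close> d_i with \<open>E\<close>. Only the terms x_d d_d of \<open>euler_diff\<close>
    will be inserted.\<close>
  define F where "F i b1 = (\<Sum>j\<in>?I. \<Sum>b2\<in>?B. E j b2 * brk_basis m n p t b1 i b2 j k c)" for i b1
  have F: "F d ((\<lambda>_. 0), {d}) = of_int (odd_weight d k (snd c)) * E k c" if d: "d \<in> I1 m n" for d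
  proof -
    have "F d ((\<lambda>_. 0), {d})
        = (\<Sum>j\<in>?I. \<Sum>b2\<in>?B. if j = k \<and> b2 = c then of_int (odd_weight d k (snd c)) * E k c else 0)"
      unfolding F_def
    proof (intro sum.cong refl)
      fix j b2 assume "j \<in> ?I" "b2 \<in> ?B"
      then show "E j b2 * brk_basis m n p t ((\<lambda>_. 0), {d}) d b2 j k c
          = (if j = k \<and> b2 = c then of_int (odd_weight d k (snd c)) * E k c else 0)"
        by (cases b2) (auto simp: brk_basis_euler[OF d] singleW_def mono_def)
    qed
    also have "\<dots> = (\<Sum>j\<in>?I. if j = k then
        (\<Sum>b2\<in>?B. if b2 = c then of_int (odd_weight d k (snd c)) * E k c else 0) else 0)"
      by (rule sum.cong) auto
    also have "\<dots> = (if k \<in> ?I \<and> c \<in> ?B then of_int (odd_weight d k (snd c)) * E k c else 0)"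
      using fI finite_Basis by simp
    also have "\<dots> = of_int (odd_weight d k (snd c)) * E k c"
    \<comment> \<open>The identity also holds off the finite basis, where \<open>E\<close> in
      \<open>Wset\<close> has only zero coefficients.\<close>
    proof (cases "E k c = 0")
      case False
      then have "k \<in> ?I \<and> c \<in> ?B" using E unfolding Wset_def by blast
      then show ?thesis by simp
    qed simp
    finally show ?thesis .
  qed
  have "brk m n p t (euler_diff a b) E k c
      = (\<Sum>i\<in>?I. \<Sum>j\<in>?I. \<Sum>b1\<in>?B. \<Sum>b2\<in>?B.
          euler_diff a b i b1 * (E j b2 * brk_basis m n p t b1 i b2 j k c))"
    by (simp add: brk_def mult.assoc)
  also have "\<dots> = (\<Sum>i\<in>?I. \<Sum>b1\<in>?B. euler_diff a b i b1 * F i b1)"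
    unfolding F_def sum_distrib_left by (intro sum.cong refl sum.swap)
  also have "\<dots> = (\<Sum>i\<in>?I. \<Sum>b1\<in>?B. singleW b (mono ((\<lambda>_. 0), {b})) i b1 * F i b1)
      - (\<Sum>i\<in>?I. \<Sum>b1\<in>?B. singleW a (mono ((\<lambda>_. 0), {a})) i b1 * F i b1)"
    by (simp add: euler_diff_def left_diff_distrib sum_subtractf)
  also have "\<dots> = of_int (odd_weight b k (snd c) - odd_weight a k (snd c)) * E k c"
    by (simp only: euler[OF a] euler[OF b] F[OF a] F[OF b]) (simp add: algebra_simps)
  finally show ?thesis .
qed

section \<open>Support of the generators D_H(x^(alpha) x^u)\<close>

lemma DH_basis_apply:
  fixes b :: mon
  assumes "b \<in> Basis m n p t"
  shows "DH_basis m n p t b k c = (\<Sum>i\<in>Iset m n.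
    if primeidx m n i = k
    then tau m i * (-1) ^ (mu m n i * card (snd b)) * dbasis m n i b c else (0::'a::field))"
  unfolding DH_basis_def dO_mono[OF assms] by (rule sum.cong) (auto simp: singleW_def)

text \<open>A nonzero coefficient needs a nonzero summand. Only its shape is recorded, because
  weights do not see signs.\<close>

lemma DH_basis_nonzeroE:
  assumes "(\<alpha>, u) \<in> Basis m n p t" "DH_basis m n p t (\<alpha>, u) k c \<noteq> (0::'a::field)"
  obtains (even_var) i where "i \<in> I0 m" "k = primeidx m n i" "c = (\<alpha>(i := \<alpha> i - 1), u)"
  | (odd_var) i where "i \<in> I1 m n" "i \<in> u" "k = primeidx m n i" "c = (\<alpha>, u - {i})"
proof -
  obtain i where i: "i \<in> Iset m n" "primeidx m n i = k"
    and nz: "dbasis m n i (\<alpha>, u) c \<noteq> (0::'a)"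
    using assms(2) unfolding DH_basis_apply[OF assms(1)]
    by (auto elim!: sum.not_neutral_contains_not_neutral split: if_splits)
  from nz show thesis
    using i that
    by (fastforce simp: dbasis_def mono_def split: if_splits)
qed

lemma primeidx_I0: "even m \<Longrightarrow> i \<in> I0 m \<Longrightarrow> primeidx m n i \<in> I0 m"
  by (auto simp: primeidx_def I0_def Let_def elim!: evenE)

lemma primeidx_I1: "even n \<Longrightarrow> i \<in> I1 m n \<Longrightarrow> primeidx m n i \<in> I1 m n"
  by (auto simp: primeidx_def I1_def Let_def elim!: evenE)

lemma DH_basis_Wset:
  assumes "even m" "even n" "b \<in> Basis m n p t"
  shows "(DH_basis m n p t b :: 'a::field Wel) \<in> Wset m n p t"
proof -
  obtain \<alpha> u where b: "b = (\<alpha>, u)" by (cases b)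
  have "k \<in> Iset m n \<and> c \<in> Basis m n p t" if "DH_basis m n p t b k c \<noteq> (0::'a)" for k c
    using assms(3)[unfolded b] that[unfolded b]
  proof (cases rule: DH_basis_nonzeroE)
    case (even_var i)
    then show ?thesis
      using primeidx_I0[OF assms(1), of i n] Basis_lower_even assms(3) b
      by (auto simp: Iset_def I0_def)
  next
    case (odd_var i)
    then show ?thesis
      using primeidx_I1[OF assms(2), of i m] Basis_remove_odd assms(3) b
      by (auto simp: Iset_def I1_def)
  qed
  then show ?thesis by (auto simp: Wset_def)
qed

section \<open>Paired odd variables: diagonal elements and their weights\<close>

lemma odd_pair_I1:
  assumes "even n" "q \<in> {1..n div 2}"
  shows "m + q \<in> I1 m n" "m + q + n div 2 \<in> I1 m n"
  using assms by (auto simp: I1_def)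

text \<open>The factor depending on the parity of f is 1, as x_a x_b is even, and \<open>tau\<close>
  is 1 on odd indices. The one minus sign comes from moving d_b past x_a.\<close>

lemma DH_basis_odd_pair:
  assumes "even n" and q: "q \<in> {1..n div 2}"
  shows "DH_basis m n p t ((\<lambda>_. 0), {m + q, m + q + n div 2})
    = (euler_diff (m + q) (m + q + n div 2) :: 'a::field Wel)"
proof (intro ext)
  fix k c
  define a b where ab: "a = m + q" "b = m + q + n div 2"
  have a: "a \<in> I1 m n" and b: "b \<in> I1 m n" using odd_pair_I1[OF assms] by (simp_all add: ab)
  have "a < b" using q by (simp add: ab)
  have pr: "primeidx m n a = b" "primeidx m n b = a"
    using q \<open>even n\<close> by (auto simp: primeidx_def ab Let_def)
  have tau: "tau m a = (1::'a)" "tau m b = (1::'a)"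
    using q by (auto simp: tau_def ab)
  have bas: "((\<lambda>_. 0), {a, b}) \<in> Basis m n p t"
    using a b by (auto simp: Basis_def Aset_def)
  have "{j. (j = a \<or> j = b) \<and> j < a} = {}" "{j. (j = a \<or> j = b) \<and> j < b} = {a}"
    using \<open>a < b\<close> by auto
  moreover have "{a, b} - {a} = {b}" "{a, b} - {b} = {a}" using \<open>a < b\<close> by auto
  ultimately have db: "dbasis m n a ((\<lambda>_. 0), {a, b}) c = (mono ((\<lambda>_. 0), {b}) c :: 'a)"
    "dbasis m n b ((\<lambda>_. 0), {a, b}) c = (- mono ((\<lambda>_. 0), {a}) c :: 'a)"
    using a b not_I0_if_I1[OF a] not_I0_if_I1[OF b]
    by (simp_all add: dbasis_def del: Collect_empty_eq)
  have dz: "dbasis m n i ((\<lambda>_. 0), {a, b}) c = (0::'a)" if "i \<notin> {a, b}" for i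
    using that by (simp add: dbasis_def)
  have card: "card {a, b} = 2" using \<open>a < b\<close> by simp
  have "DH_basis m n p t ((\<lambda>_. 0), {a, b}) k c = (\<Sum>i\<in>{a, b}.
      if primeidx m n i = k then tau m i * (-1) ^ (mu m n i * 2)
        * dbasis m n i ((\<lambda>_. 0), {a, b}) c else (0::'a))"
    unfolding DH_basis_apply[OF bas] snd_conv card
    using a b by (intro sum.mono_neutral_right) (auto simp: Iset_def I1_def dz)
  also have "\<dots> = euler_diff a b k c"
    using \<open>a < b\<close> by (auto simp: pr tau db euler_diff_def singleW_def)
  finally show "DH_basis m n p t ((\<lambda>_. 0), {m + q, m + q + n div 2}) k c
      = (euler_diff (m + q) (m + q + n div 2) k c :: 'a)"
    by (simp add: ab)
qed

lemma euler_diff_Wdeg: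
  assumes "even n" "q \<in> {1..n div 2}"
  shows "(euler_diff (m + q) (m + q + n div 2) :: 'a::field Wel) \<in> Wdeg m n p t 0"
proof -
  have "((\<lambda>_. 0), {m + q}) \<in> Basis m n p t" "((\<lambda>_. 0), {m + q + n div 2}) \<in> Basis m n p t"
    using Basis_odd_var odd_pair_I1[OF assms] by auto
  moreover have "m + q \<in> Iset m n" "m + q + n div 2 \<in> Iset m n"
    using odd_pair_I1[OF assms] by (auto simp: Iset_def I1_def)
  ultimately show ?thesis
    by (auto simp: Wdeg_def Wset_def euler_diff_def singleW_def mono_def zdeg_def
        split: if_splits)
qed

text \<open>The index \<open>0\<close> lies outside \<open>I\<close>, so \<open>k = 0\<close> gives the weight of \<open>x^v\<close> in \<open>O\<close> itself.\<close>
definition pair_weight :: "nat \<Rightarrow> nat \<Rightarrow> nat \<Rightarrow> nat \<Rightarrow> nat set \<Rightarrow> int" where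
  "pair_weight m n q k v = odd_weight (m + q + n div 2) k v - odd_weight (m + q) k v"

text \<open>D_H couples d_i(f) with the derivation of the partner index. For i in the pair, the
  weight lost by deleting x_i is made up by the partner derivation, since the two indices count with
  opposite signs.\<close>

lemma pair_weight_DH_basis:
  assumes "even m" "even n" and q: "q \<in> {1..n div 2}"
    and "(\<alpha>, u) \<in> Basis m n p t" "DH_basis m n p t (\<alpha>, u) k c \<noteq> (0::'a::field)"
  shows "pair_weight m n q k (snd c) = pair_weight m n q 0 u"
  using assms(4,5)
proof (cases rule: DH_basis_nonzeroE)
  case (even_var i)
  then have "k \<in> I0 m" using primeidx_I0[OF assms(1)] by simp
  then show ?thesis
    using even_var q by (auto simp: pair_weight_def odd_weight_def I0_def)
next
  case (odd_var i)
  define a b where ab: "a = m + q" "b = m + q + n div 2"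
  have "m < i" "i \<le> m + n" using odd_var by (auto simp: I1_def)
  \<comment> \<open>The partner map exchanges \<open>a\<close> and \<open>b\<close> and sends no
    other odd index to either.\<close>
  then have "k = a \<longleftrightarrow> i = b" "k = b \<longleftrightarrow> i = a"
    using odd_var(3) q \<open>even n\<close>
    by (auto simp: primeidx_def Let_def ab elim!: evenE)
  moreover have "a \<noteq> b" "a \<noteq> 0" "b \<noteq> 0" using q by (auto simp: ab)
  moreover have "pair_weight m n q l v = odd_weight b l v - odd_weight a l v" for l v
    by (simp add: pair_weight_def ab)
  ultimately show ?thesis
    using odd_var(2,4) by (cases "i = a"; cases "i = b") (auto simp: odd_weight_def)
qed

lemma sum_shift_atLeastAtMost:
  "(\<Sum>i\<in>{m + 1..m + s}. f i) = (\<Sum>q\<in>{1..s}. f (m + q) :: 'b::comm_monoid_add)" for m s :: nat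
  by (rule sum.reindex_bij_witness[of _ "\<lambda>q. m + q" "\<lambda>i. i - m"]) auto

text \<open>Modulo 2 a difference is a sum, so the pair weights add up to the total weight over all
  odd indices, which is the number of odd variables minus the parity of the derivation. Evenness of
  \<open>n\<close> ensures that the pairs exhaust \<open>I1\<close>.\<close>

lemma even_sum_pair_weight:
  assumes "even n" "v \<subseteq> I1 m n"
  shows "even (\<Sum>q\<in>{1..n div 2}. pair_weight m n q k v) \<longleftrightarrow> even (card v + mu m n k)"
proof -
  obtain s where "n = 2 * s" using assms(1) by (elim evenE)
  then have n: "n = s + s" and half: "n div 2 = s" by simp_all
  have fin: "finite (I1 m n)" by (simp add: I1_def)
  let ?w = "\<lambda>i. odd_weight i k v"
  have "(\<Sum>i\<in>I1 m n. ?w i) = (\<Sum>i\<in>{m + 1..m + s}. ?w i) + (\<Sum>i\<in>{m + s + 1..m + s + s}. ?w i)"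
    unfolding n I1_def by (subst sum.ub_add_nat [symmetric]) (simp_all add: add.assoc)
  also have "\<dots> = (\<Sum>q\<in>{1..s}. ?w (m + q) + ?w (m + q + s))"
    unfolding sum_shift_atLeastAtMost by (simp add: sum.distrib ac_simps)
  \<comment> \<open>Rewrites a + b as (b - a) + 2a.\<close>
  also have "\<dots> = (\<Sum>q\<in>{1..s}. pair_weight m n q k v + 2 * ?w (m + q))"
    by (rule sum.cong) (simp_all add: pair_weight_def half)
  also have "\<dots> = (\<Sum>q\<in>{1..s}. pair_weight m n q k v) + 2 * (\<Sum>q\<in>{1..s}. ?w (m + q))"
    by (simp only: sum.distrib sum_distrib_left)
  finally have "even (\<Sum>q\<in>{1..s}. pair_weight m n q k v) \<longleftrightarrow> even (\<Sum>i\<in>I1 m n. ?w i)"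
    by simp
  also have "(\<Sum>i\<in>I1 m n. ?w i) = int (card v) - int (mu m n k)"
  proof -
    have "(\<Sum>i\<in>I1 m n. of_bool (i \<in> v) :: int) = int (card v)"
      using assms(2) fin by (simp add: sum.If_cases of_bool_def Int_absorb1)
    moreover have "(\<Sum>i\<in>I1 m n. of_bool (k = i) :: int) = int (mu m n k)"
      using fin by (simp add: of_bool_def mu_def)
    ultimately show ?thesis by (simp add: odd_weight_def sum_subtractf)
  qed
  finally show ?thesis by (simp add: half)
qed

lemma abs_pair_weight_le: "\<bar>pair_weight m n q k v\<bar> \<le> 2"
  by (auto simp: pair_weight_def odd_weight_def of_bool_def)

text \<open>Both paired indices are positive, so with \<open>k = 0\<close> no derivation contributes
  and a difference of two numbers in {0, 1} remains. With the general bound 2, two such weights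
  differ by at most 3, which is where \<open>p > 3\<close> enters.\<close>

lemma abs_pair_weight_zero_le:
  assumes "q \<in> {1..n div 2}"
  shows "\<bar>pair_weight m n q 0 v\<bar> \<le> 1"
  using assms by (auto simp: pair_weight_def odd_weight_def of_bool_def)

lemma of_int_eq_imp_eq_if_small:
  fixes a b :: int
  assumes "(of_int a :: 'a::ring_1) = of_int b" "\<bar>a - b\<bar> < int CHAR('a)"
  shows "a = b"
proof -
  have "(of_int (a - b) :: 'a) = 0" using assms(1) by simp
  then have "int CHAR('a) dvd a - b" by (simp only: of_int_eq_0_iff_char_dvd)
  then show ?thesis using assms(2) zdvd_imp_le[of "int CHAR('a)" "\<bar>a - b\<bar>"] by auto
qed

section \<open>Generators and eigenvectors in \<open>H0\<close>\<close>

lemma finite_H0gens: "finite (H0gens m n p t)"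
  using finite_Basis by (rule finite_subset[rotated]) (auto simp: H0gens_def)

lemma DH_basis_H0:
  assumes "b \<in> H0gens m n p t"
  shows "DH_basis m n p t b \<in> H0 m n p t"
proof -
  have "DH_basis m n p t b
      = (\<lambda>k c. \<Sum>b'\<in>H0gens m n p t. mono b b' * DH_basis m n p t b' k c)"
    using assms by (simp add: sum_mono_mult finite_H0gens)
  then show ?thesis by (auto simp: H0_def)
qed

lemma brk_zero_left [simp]: "brk m n p t (\<lambda>k c. 0) E = (\<lambda>k c. 0)"
  by (simp add: brk_def)

lemma brk_euler_diff_DH_basis:
  assumes "even m" "even n" "q \<in> {1..n div 2}" "b \<in> Basis m n p t"
  shows "brk m n p t (euler_diff (m + q) (m + q + n div 2)) (DH_basis m n p t b)
    = (\<lambda>k c. of_int (pair_weight m n q 0 (snd b)) * DH_basis m n p t b k c :: 'a::field)"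
proof (intro ext)
  fix k c
  obtain \<alpha> u where b: "b = (\<alpha>, u)" by (cases b)
  show "brk m n p t (euler_diff (m + q) (m + q + n div 2)) (DH_basis m n p t b) k c
      = (of_int (pair_weight m n q 0 (snd b)) * DH_basis m n p t b k c :: 'a)"
    unfolding brk_euler_diff[OF odd_pair_I1[OF assms(2,3)] DH_basis_Wset[OF assms(1,2,4)]]
  proof (cases "DH_basis m n p t b k c = (0::'a)")
    case False
    then have "pair_weight m n q k (snd c) = pair_weight m n q 0 (snd b)"
      using pair_weight_DH_basis[OF assms(1-3), of \<alpha> u p t k c] assms(4) by (simp add: b)
    then show "of_int (odd_weight (m + q + n div 2) k (snd c) - odd_weight (m + q) k (snd c))
        * DH_basis m n p t b k c
        = (of_int (pair_weight m n q 0 (snd b)) * DH_basis m n p t b k c :: 'a)"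
      by (simp only: pair_weight_def)
  qed simp
qed

text \<open>For n = 2 the pair is all of \<open>I1\<close>, so the exponent must separate this
  monomial from the excluded one: \<open>piv\<close> is positive at index 1, while the exponent here
  is zero.\<close>

lemma odd_pair_H0gens:
  assumes "m > 0" "p > 1" "\<forall>i\<in>I0 m. t i > 0" "even n" "q \<in> {1..n div 2}"
  shows "((\<lambda>_. 0), {m + q, m + q + n div 2}) \<in> H0gens m n p t"
proof -
  have "1 \<in> I0 m" using assms(1) by (simp add: I0_def)
  then have "piv m p t 1 > 0"
    using assms(2,3) one_less_power[of p "t 1"] by (simp add: piv_def)
  then have "piv m p t \<noteq> (\<lambda>_. 0)" by (metis less_irrefl)
  then show ?thesis
    using odd_pair_I1[OF assms(4,5), of m] assms(5) by (auto simp: H0gens_def Basis_def Aset_def)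
qed

section \<open>Vanishing of the derivation on generators and on their span\<close>

theorem theorem4p9:
  fixes m n p :: nat and t :: "nat \<Rightarrow> nat" and \<phi> :: "'a::field Wel \<Rightarrow> 'a Wel"
  assumes "prime p" and "p > 3" and "CHAR('a) = p" and "alg_closed TYPE('a)"
    and "m > 0" and "even m" and "n > 0" and "even n"
    and "\<forall>i\<in>I0 m. t i > 0"
    and into_odd: "\<forall>x\<in>H0 m n p t. \<phi> x \<in> Wodd m n p t"
    and additive: "\<forall>x\<in>H0 m n p t. \<forall>y\<in>H0 m n p t. \<phi> (\<lambda>k c. x k c + y k c) = (\<lambda>k c. \<phi> x k c + \<phi> y k c)"
    and homog_scalar: "\<forall>a::'a. \<forall>x\<in>H0 m n p t. \<phi> (\<lambda>k c. a * x k c) = (\<lambda>k c. a * \<phi> x k c)"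
    and derivation: "\<forall>x\<in>H0 m n p t. \<forall>y\<in>H0 m n p t.
       \<phi> (brk m n p t x y) = (\<lambda>k c. brk m n p t (\<phi> x) y k c + brk m n p t x (\<phi> y) k c)"
    and Z_homogeneous: "\<exists>d::int. \<forall>k::int. \<forall>x\<in>H0 m n p t \<inter> Wdeg m n p t k. \<phi> x \<in> Wdeg m n p t (k + d)"
    and vanish_m1: "\<forall>x\<in>H0 m n p t \<inter> Wdeg m n p t (-1). \<phi> x = (\<lambda>k c. 0)"
    and vanish_0: "\<forall>x\<in>H0 m n p t \<inter> Wdeg m n p t 0. \<phi> x = (\<lambda>k c. 0)"
  shows "\<forall>x\<in>H0 m n p t. \<phi> x = (\<lambda>k c. 0)"
proof -
  have m: "even m" and n: "even n" by fact+
  have generator: "\<phi> (DH_basis m n p t b) = (\<lambda>k c. 0)" if b: "b \<in> H0gens m n p t" for b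
  proof (intro ext)
    fix k c
    let ?x = "DH_basis m n p t b :: 'a Wel"
    have bB: "b \<in> Basis m n p t" and parity: "even (card (snd b))"
      using b by (auto simp: H0gens_def)
    have xH: "?x \<in> H0 m n p t" by (rule DH_basis_H0[OF b])
    have \<phi>W: "\<phi> ?x \<in> Wset m n p t" using into_odd xH by (auto simp: Wodd_def)
    show "\<phi> ?x k c = 0"
    proof (rule ccontr)
      assume nz: "\<phi> ?x k c \<noteq> 0"
      have "pair_weight m n q k (snd c) = pair_weight m n q 0 (snd b)" if q: "q \<in> {1..n div 2}" for q
      proof (rule of_int_eq_imp_eq_if_small[where 'a = 'a])
        let ?h = "euler_diff (m + q) (m + q + n div 2) :: 'a Wel"
        have hH: "?h \<in> H0 m n p t"
          unfolding DH_basis_odd_pair[OF n q, where p = p and t = t, symmetric]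
          using \<open>m > 0\<close> \<open>p > 3\<close> \<open>\<forall>i\<in>I0 m. t i > 0\<close> n q
          by (intro DH_basis_H0 odd_pair_H0gens) simp_all
        then have "\<phi> ?h = (\<lambda>k c. 0)"
          using vanish_0 euler_diff_Wdeg[OF n q] by blast
        moreover have "\<phi> (brk m n p t ?h ?x)
            = (\<lambda>k c. brk m n p t (\<phi> ?h) ?x k c + brk m n p t ?h (\<phi> ?x) k c)"
          using derivation hH xH by blast
        \<comment> \<open>Second evaluation of the same bracket: the generator is an eigenvector of
          \<open>?h\<close>, so \<phi> only scales.\<close>
        moreover have "\<phi> (brk m n p t ?h ?x)
            = (\<lambda>k c. of_int (pair_weight m n q 0 (snd b)) * \<phi> ?x k c)"
          unfolding brk_euler_diff_DH_basis[OF m n q bB] using homog_scalar xH by blast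
        ultimately have "of_int (pair_weight m n q 0 (snd b)) * \<phi> ?x k c
            = brk m n p t ?h (\<phi> ?x) k c"
          by (auto dest: fun_cong)
        \<comment> \<open>\<open>?h\<close> acts on the coefficient at \<open>(k, c)\<close> by its
          own weight; the nonzero coefficient is then cancelled.\<close>
        then show "(of_int (pair_weight m n q k (snd c)) :: 'a) = of_int (pair_weight m n q 0 (snd b))"
          using nz by (simp add: brk_euler_diff[OF odd_pair_I1[OF n q] \<phi>W] pair_weight_def)
        show "\<bar>pair_weight m n q k (snd c) - pair_weight m n q 0 (snd b)\<bar> < int CHAR('a)"
          using abs_pair_weight_le[of m n q k "snd c"] abs_pair_weight_zero_le[OF q, of m "snd b"]
            \<open>p > 3\<close> \<open>CHAR('a) = p\<close> by linarith
      qed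
      then have "(\<Sum>q\<in>{1..n div 2}. pair_weight m n q k (snd c))
          = (\<Sum>q\<in>{1..n div 2}. pair_weight m n q 0 (snd b))"
        by (intro sum.cong) auto
      moreover have "c \<in> Basis m n p t"
        using nz \<phi>W unfolding Wset_def by blast
      then have "snd c \<subseteq> I1 m n" "snd b \<subseteq> I1 m n"
        using bB by (auto simp: Basis_def)
      \<comment> \<open>Index 0 is not odd, so the right side is just the parity of u, which is
        even; the left side is odd.\<close>
      ultimately have "even (card (snd c) + mu m n k) \<longleftrightarrow> even (card (snd b) + mu m n 0)"
        using even_sum_pair_weight[OF n] by metis
      moreover have "odd (card (snd c) + mu m n k)"
        using into_odd xH nz unfolding Wodd_def par_def by blast
      ultimately show False using parity by (simp add: mu_def I1_def)
    qed
  qed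
  \<comment> \<open>Partial sums lie in \<open>H0\<close> after padding with zero
    coefficients.\<close>
  have sum_H0: "(\<lambda>k c. \<Sum>b\<in>S. a b * DH_basis m n p t b k c) \<in> H0 m n p t"
    if "S \<subseteq> H0gens m n p t" for a :: "mon \<Rightarrow> 'a" and S
  proof -
    have "(\<Sum>b\<in>S. a b * DH_basis m n p t b k c)
        = (\<Sum>b\<in>H0gens m n p t. (if b \<in> S then a b else 0) * DH_basis m n p t b k c)" for k c
      using that finite_H0gens by (intro sum.mono_neutral_cong_left) auto
    then show ?thesis unfolding H0_def mem_Collect_eq by (intro exI ext)
  qed
  \<comment> \<open>Additivity is given only inside \<open>H0\<close>, so the induction runs over
    subsets of the generators, whose partial sums stay there.\<close>
  have span: "\<phi> (\<lambda>k c. \<Sum>b\<in>S. a b * DH_basis m n p t b k c) = (\<lambda>k c. 0)"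
    if "finite S" "S \<subseteq> H0gens m n p t" for a :: "mon \<Rightarrow> 'a" and S
    using that
  proof (induction S rule: finite_induct)
    case empty
    have "(\<lambda>k c. 0 :: 'a) \<in> H0 m n p t" using sum_H0[of "{}"] by simp
    from homog_scalar[rule_format, OF this, of 0] show ?case by simp
  next
    case (insert b S)
    have b: "b \<in> H0gens m n p t" using insert.prems by simp
    have "\<phi> (\<lambda>k c. a b * DH_basis m n p t b k c) = (\<lambda>k c. a b * \<phi> (DH_basis m n p t b) k c)"
      using homog_scalar DH_basis_H0[OF b] by blast
    then have "\<phi> (\<lambda>k c. a b * DH_basis m n p t b k c) = (\<lambda>k c. 0)"
      by (simp add: generator[OF b])
    moreover have "(\<lambda>k c. a b * DH_basis m n p t b k c) \<in> H0 m n p t"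
      using sum_H0[of "{b}" a] b by simp
    ultimately have "\<phi> (\<lambda>k c. a b * DH_basis m n p t b k c + (\<Sum>b\<in>S. a b * DH_basis m n p t b k c))
        = (\<lambda>k c. 0)"
      using additive sum_H0[of S a] insert by simp
    then show ?case using insert.hyps by simp
  qed
  show ?thesis using span[OF finite_H0gens] by (auto simp: H0_def)
qed

end
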